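(* Let $s,t$ be variables and define polynomials $F_n$ by $F_0=0$, $F_1=1$, $F_n=sF_{n-1}+tF_{n-2}$ ($n\ge2$), and let $\left\{\begin{matrix} n\\ k\end{matrix}\right\}=\frac{F_n!}{F_k!F_{n-k}!}$ for $0\le k\le n$, where $F_n!=F_1F_2\cdots F_n$ and $F_0!=1$. Then for all integers $m,n\ge 0$, $$\left\{\begin{matrix} m+n\\ m\end{matrix}\right\}=\sum_{\lambda\subseteq m\times n}\ \sum_{T\in\mathcal{L}_\lambda\times\mathcal{L}'_{\lambda^*}} w(T)$$ and $$2^{m+n}\left\{\begin{matrix} m+n\\ m\end{matrix}\right\}=\sum_{\lambda\subseteq m\times n}\ \sum_{T\in\mathcal{C}_\lambda\times\mathcal{C}_{\lambda^*}} w(T),$$ where in the first identity the weights are linear weights and in the second they are circular weights (as defined in the context).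
   Context: A partition $\lambda=(\lambda_1,\dots,\lambda_m)$ is a weakly decreasing sequence of nonnegative integers (zero parts allowed). We write $\lambda\subseteq m\times n$ if $\lambda$ has exactly $m$ parts each at most $n$; its Ferrers diagram consists of $m$ left-justified rows with $\lambda_i$ boxes in row $i$, sitting inside an $m\times n$ rectangle. Then $\lambda^*=(\lambda^*_1,\dots,\lambda^*_n)$ is the partition (with $n$ parts, zeros allowed) whose parts are the lengths of the columns of the complement of $\lambda$ in the $m\times n$ rectangle. A linear tiling of a $1\times \ell$ row of $\ell$ squares is a covering by disjoint monominos (covering one square) and dominos (covering two adjacent squares); $\mathcal{L}_\ell$ is the set of these (for $\ell=0$ it consists of the empty tiling). $\mathcal{L}'_\ell\subseteq\mathcal{L}_\ell$ is the set of linear tilings not beginning with a monomino (so $\mathcal{L}'_0=\{\text{empty tiling}\}$, $\mathcal{L}'_1=\emptyset$). A circular tiling of a $1\times\ell$ row is like a linear tiling except that the left edge of the first square and right edge of the last square are identified, so a domino may also cover the last and first squares together; $\mathcal{C}_\ell$ is the set of these. For a sequence $\mu=(\mu_1,\dots,\mu_r)$ of nonnegative integers, $\mathcal{L}_\mu=\mathcal{L}_{\mu_1}\times\cdots\times\mathcal{L}_{\mu_r}$, and similarly $\mathcal{L}'_\mu$, $\mathcal{C}_\mu$; thus an element of $\mathcal{L}_\lambda$ tiles each row of $\lambda$ and an element of $\mathcal{L}'_{\lambda^*}$ (or $\mathcal{C}_{\lambda^*}$) tiles each column of the complement. Weights: a tiling of a single row with $a$ monominos and $b$ dominos has weight $s^a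 t^b$, except that in the circular setting the empty tiling (of a row of length $0$) has weight $2$, while in the linear setting the empty tiling has weight $1$. The weight $w(T)$ of a tuple of tilings is the product of the weights of its components. *)

theory Defs
  imports "HOL-Computational_Algebra.Computational_Algebra"
begin

text \<open>The polynomial ring $\mathbb{Z}[s,t]$ is modelled as $(\mathbb{Z}[t])[s]$: the variable \<open>s\<close>
  is the outer indeterminate, the variable \<open>t\<close> the inner one.\<close>

type_synonym poly_st = "int poly poly"

definition var_s :: poly_st where
  "var_s = [:0, 1:]"

definition var_t :: poly_st where
  "var_t = [:[:0, 1:]:]"

fun lucas_poly :: "nat \<Rightarrow> poly_st" where
  "lucas_poly 0 = 0"
| "lucas_poly (Suc 0) = 1"
| "lucas_poly (Suc (Suc n)) = var_s * lucas_poly (Suc n) + var_t * lucas_poly n"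

definition lucas_fact :: "nat \<Rightarrow> poly_st" where
  "lucas_fact n = (\<Prod>i=1..n. lucas_poly i)"

text \<open>The quotient of Lucas factorials is formed in the field of rational functions
  in \<open>s\<close> and \<open>t\<close>; it is only meant for \<open>k \<le> n\<close>.\<close>

definition lucasnomial :: "nat \<Rightarrow> nat \<Rightarrow> poly_st fract" where
  "lucasnomial n k = Fract (lucas_fact n) 1 / (Fract (lucas_fact k) 1 * Fract (lucas_fact (n - k)) 1)"

definition partitions_in :: "nat \<Rightarrow> nat \<Rightarrow> nat list set" where
  "partitions_in m n = {lam. length lam = m \<and> sorted_wrt (\<ge>) lam \<and> (\<forall>p\<in>set lam. p \<le> n)}"

text \<open>Rows, columns and squares are numbered from \<open>0\<close>; boxes are pairs (row, column).\<close>

definition ferrers :: "nat list \<Rightarrow> (nat \<times> nat) set" where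
  "ferrers lam = {(i, j). i < length lam \<and> j < lam ! i}"

text \<open>The column lengths of the complement increase from left to right, so they are listed
  from the last column to the first to obtain a weakly decreasing sequence.\<close>

definition compl_columns :: "nat \<Rightarrow> nat \<Rightarrow> nat list \<Rightarrow> nat list" where
  "compl_columns m n lam =
     map (\<lambda>j. card {i. (i, j) \<in> ({..<m} \<times> {..<n}) - ferrers lam}) (rev [0..<n])"

text \<open>A tile is named by its kind and its first square, not by the set of squares it covers:
  on a circular row of length \<open>2\<close> there are two different dominos covering the same squares.\<close>

datatype tile = Monomino nat | Domino nat

fun covered :: "nat \<Rightarrow> tile \<Rightarrow> nat set" where
  "covered l (Monomino i) = {i}"
| "covered l (Domino i) = {i, Suc i mod l}"

definition linear_tiles :: "nat \<Rightarrow> tile set" where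
  "linear_tiles l = {Monomino i | i. i < l} \<union> {Domino i | i. Suc i < l}"

text \<open>A domino covers two distinct squares, so none fits on a circular row of length \<open>1\<close>.\<close>

definition circular_tiles :: "nat \<Rightarrow> tile set" where
  "circular_tiles l = {Monomino i | i. i < l} \<union> {Domino i | i. i < l \<and> 2 \<le> l}"

definition exact_cover :: "nat \<Rightarrow> tile set \<Rightarrow> bool" where
  "exact_cover l T \<longleftrightarrow> (\<forall>x<l. \<exists>!d. d \<in> T \<and> x \<in> covered l d)"

definition linear_tilings :: "nat \<Rightarrow> tile set set" where
  "linear_tilings l = {T. T \<subseteq> linear_tiles l \<and> exact_cover l T}"

definition linear_tilings' :: "nat \<Rightarrow> tile set set" where
  "linear_tilings' l = {T \<in> linear_tilings l. Monomino 0 \<notin> T}"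

definition circular_tilings :: "nat \<Rightarrow> tile set set" where
  "circular_tilings l = {T. T \<subseteq> circular_tiles l \<and> exact_cover l T}"

definition linear_weight :: "tile set \<Rightarrow> poly_st" where
  "linear_weight T = var_s ^ card {i. Monomino i \<in> T} * var_t ^ card {i. Domino i \<in> T}"

definition circular_weight :: "tile set \<Rightarrow> poly_st" where
  "circular_weight T = (if T = {} then 2 else linear_weight T)"

text \<open>Elements of a product of sets of tilings over the parts of a sequence are lists, via
  \<^const>\<open>listset\<close>; \<open>w\<close> is the weight of a single row.\<close>

definition tuple_weight :: "(tile set \<Rightarrow> poly_st) \<Rightarrow> tile set list \<times> tile set list \<Rightarrow> poly_st" where
  "tuple_weight w T = prod_list (map w (fst T)) * prod_list (map w (snd T))"

end

theory Submission
  imports Defs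
begin

text \<open>The tilings of a row of length \<open>l\<close> have total weight \<open>F\<^bsub>l+1\<^esub>\<close> in the linear case,
  \<open>t F\<^bsub>l-1\<^esub>\<close> for \<open>l > 0\<close> if no initial monomino is allowed, and \<open>F\<^bsub>l+1\<^esub> + t F\<^bsub>l-1\<^esub>\<close> for \<open>l > 0\<close> in the
  circular case, where the second summand counts the tilings with a domino across the seam.
  If row lengths \<open>l\<close> are weighted by \<open>A l\<close> and column lengths by \<open>B l\<close>, then distinguishing whether
  the first row of \<open>\<lambda>\<close> is full or the last column of its complement is full shows that the sum
  \<open>S m n\<close> over \<open>\<lambda> \<subseteq> m \<times> n\<close> satisfies \<open>S m n = A n * S (m - 1) n + B m * S m (n - 1)\<close>.
  Both identities follow by induction on \<open>m + n\<close> from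
  \<open>F\<^bsub>m+n\<^esub> = F\<^bsub>n+1\<^esub> F\<^bsub>m\<^esub> + t F\<^bsub>m-1\<^esub> F\<^bsub>n\<^esub>\<close>, used once in the linear and twice, with \<open>m\<close> and \<open>n\<close> exchanged,
  in the circular case.\<close>

section \<open>Exact covers\<close>

text \<open>The region \<open>X\<close> is a parameter, so that removing a tile leaves an exact
  cover of a smaller region from the same stock \<open>C\<close>.\<close>

definition exact_covers :: "'b set \<Rightarrow> ('b \<Rightarrow> 'a set) \<Rightarrow> 'a set \<Rightarrow> 'b set set" where
  "exact_covers C c X = {T. T \<subseteq> C \<and> (\<forall>d\<in>T. c d \<subseteq> X) \<and> (\<forall>x\<in>X. \<exists>!d. d \<in> T \<and> x \<in> c d)}"

text \<open>Tiles leaving \<open>X\<close> never occur, so only tiles inside \<open>X\<close> need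
  comparing. This serves to remove the reduction mod \<open>l\<close> from
  \<open>covered\<close>.\<close>

lemma exact_covers_cong:
  assumes "\<And>d. d \<in> C \<and> c d \<subseteq> X \<longleftrightarrow> d \<in> C' \<and> c' d \<subseteq> X"
    and "\<And>d. d \<in> C \<Longrightarrow> c d \<subseteq> X \<Longrightarrow> c d = c' d"
  shows "exact_covers C c X = exact_covers C' c' X"
proof -
  have "T \<in> exact_covers C' c' X"
    if T: "T \<in> exact_covers C c X"
      and 1: "\<And>d. c d \<subseteq> X \<Longrightarrow> d \<in> C \<Longrightarrow> d \<in> C' \<and> c d = c' d" for C C' T and c c' :: "'a \<Rightarrow> 'b set"
  proof -
    have TC: "T \<subseteq> C" and sub: "\<forall>d\<in>T. c d \<subseteq> X" and ex: "\<forall>x\<in>X. \<exists>!d. d \<in> T \<and> x \<in> c d"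
      using T by (auto simp: exact_covers_def)
    have eq: "d \<in> C' \<and> c d = c' d" if "d \<in> T" for d
      using 1 TC sub that by blast
    have "(d \<in> T \<and> x \<in> c d) = (d \<in> T \<and> x \<in> c' d)" for d x
      using eq by auto
    with ex have "\<forall>x\<in>X. \<exists>!d. d \<in> T \<and> x \<in> c' d"
      by simp
    with eq sub show ?thesis
      by (auto simp: exact_covers_def)
  qed
  from this[of _ C c C' c'] this[of _ C' c' C c] show ?thesis
    using assms by (intro equalityI subsetI) metis+
qed

lemma exact_covers_empty:
  assumes "\<And>d. d \<in> C \<Longrightarrow> c d \<noteq> {}"
  shows "exact_covers C c {} = {{}}"
  using assms by (auto simp: exact_covers_def)

lemma not_mem_exact_covers_diff:
  assumes "T \<in> exact_covers C c (X - c d)" and "c d \<noteq> {}"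
  shows "d \<notin> T"
  using assms by (auto simp: exact_covers_def)

text \<open>Exactness makes the other tiles disjoint from \<open>d\<close>, so they cover precisely
  \<open>X - c d\<close>; conversely \<open>d\<close> fills the gap.\<close>

lemma exact_covers_containing:
  assumes d: "d \<in> C" "c d \<subseteq> X" and ne: "\<And>e. e \<in> C \<Longrightarrow> c e \<noteq> {}"
  shows "{T \<in> exact_covers C c X. d \<in> T} = insert d ` exact_covers C c (X - c d)"
proof (intro equalityI subsetI)
  fix T assume "T \<in> {T \<in> exact_covers C c X. d \<in> T}"
  then have TC: "T \<subseteq> C" and sub: "\<forall>e\<in>T. c e \<subseteq> X"
    and ex: "\<forall>x\<in>X. \<exists>!e. e \<in> T \<and> x \<in> c e" and dT: "d \<in> T"
    by (auto simp: exact_covers_def)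
  have disj: "c e \<inter> c d = {}" if "e \<in> T" "e \<noteq> d" for e
    using ex sub dT that by blast
  have "\<exists>!e. e \<in> T - {d} \<and> x \<in> c e" if "x \<in> X - c d" for x
    using ex that by (metis Diff_iff singletonD)
  moreover have "c e \<subseteq> X - c d" if "e \<in> T - {d}" for e
    using sub disj[of e] that by blast
  ultimately have "T - {d} \<in> exact_covers C c (X - c d)"
    using TC by (auto simp: exact_covers_def)
  then show "T \<in> insert d ` exact_covers C c (X - c d)"
    using dT by (metis image_eqI insert_Diff)
next
  fix T assume "T \<in> insert d ` exact_covers C c (X - c d)"
  then obtain U where U: "T = insert d U" "U \<subseteq> C" "\<forall>e\<in>U. c e \<subseteq> X - c d"
    "\<forall>x\<in>X - c d. \<exists>!e. e \<in> U \<and> x \<in> c e"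
    by (auto simp: exact_covers_def)
  have "\<exists>!e. e \<in> T \<and> x \<in> c e" if "x \<in> X" for x
  proof (cases "x \<in> c d")
    case True
    with U show ?thesis by blast
  next
    case False
    with U that show ?thesis by (metis Diff_iff insert_iff)
  qed
  with U d show "T \<in> {T \<in> exact_covers C c X. d \<in> T}"
    by (auto simp: exact_covers_def)
qed

text \<open>Covers of \<open>X - c d\<close> never contain \<open>d\<close>, hence inserting
  \<open>d\<close> is injective and the sum can be reindexed.\<close>

lemma sum_insert_exact_covers:
  assumes "c d \<noteq> {}"
    and "\<And>T. T \<in> exact_covers C c (X - c d) \<Longrightarrow> w (insert d T) = a * w T"
  shows "sum w (insert d ` exact_covers C c (X - c d))
       = (a :: 'r :: comm_semiring_1) * sum w (exact_covers C c (X - c d))"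
proof -
  have "inj_on (insert d) (exact_covers C c (X - c d))"
    using assms(1) by (auto intro!: inj_onI dest!: not_mem_exact_covers_diff simp: insert_ident)
  then show ?thesis
    using assms(2) by (simp add: sum.reindex sum_distrib_left)
qed

section \<open>Tilings of a single row\<close>

fun linear_covered :: "tile \<Rightarrow> nat set" where
  "linear_covered (Monomino i) = {i}"
| "linear_covered (Domino i) = {i, Suc i}"

lemma linear_covered_nonempty: "linear_covered d \<noteq> {}"
  by (cases d) auto

text \<open>Free endpoints allow tiles to be peeled off at the left end. The stock is
  \<open>UNIV\<close> because the interval itself bounds the tiles.\<close>

abbreviation interval_tilings :: "nat \<Rightarrow> nat \<Rightarrow> tile set set" where
  "interval_tilings a b \<equiv> exact_covers UNIV linear_covered {a..<b}"

lemma finite_interval_tiling: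
  assumes "T \<in> interval_tilings a b"
  shows "finite T"
proof (rule finite_subset)
  show "T \<subseteq> Monomino ` {a..<b} \<union> Domino ` {a..<b}"
  proof
    fix d assume "d \<in> T"
    with assms show "d \<in> Monomino ` {a..<b} \<union> Domino ` {a..<b}"
      by (cases d) (auto simp: exact_covers_def)
  qed
qed simp

lemma linear_weight_empty: "linear_weight {} = 1"
  by (simp add: linear_weight_def)

lemma linear_weight_insert_Monomino:
  assumes "finite T" "Monomino i \<notin> T"
  shows "linear_weight (insert (Monomino i) T) = var_s * linear_weight T"
proof -
  have "finite {j. Monomino j \<in> T}"
    using finite_vimageI[OF assms(1), of Monomino] by (auto simp: vimage_def inj_def)
  moreover have "{j. Monomino j \<in> insert (Monomino i) T} = insert i {j. Monomino j \<in> T}"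
    by auto
  ultimately show ?thesis
    using assms(2) by (simp add: linear_weight_def mult.assoc)
qed

lemma linear_weight_insert_Domino:
  assumes "finite T" "Domino i \<notin> T"
  shows "linear_weight (insert (Domino i) T) = var_t * linear_weight T"
proof -
  have "finite {j. Domino j \<in> T}"
    using finite_vimageI[OF assms(1), of Domino] by (auto simp: vimage_def inj_def)
  moreover have "{j. Domino j \<in> insert (Domino i) T} = insert i {j. Domino j \<in> T}"
    by auto
  ultimately show ?thesis
    using assms(2) by (simp add: linear_weight_def mult.left_commute)
qed

lemma interval_tilings_Monomino:
  assumes "a < b"
  shows "{T \<in> interval_tilings a b. Monomino a \<in> T} = insert (Monomino a) ` interval_tilings (Suc a) b"
proof -
  have "{a..<b} - linear_covered (Monomino a) = {Suc a..<b}" by auto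
  then show ?thesis
    using exact_covers_containing[of "Monomino a" UNIV linear_covered "{a..<b}"] assms
      linear_covered_nonempty by simp
qed

lemma interval_tilings_Domino:
  assumes "Suc a < b"
  shows "{T \<in> interval_tilings a b. Domino a \<in> T} = insert (Domino a) ` interval_tilings (Suc (Suc a)) b"
proof -
  have "{a..<b} - linear_covered (Domino a) = {Suc (Suc a)..<b}" by auto
  then show ?thesis
    using exact_covers_containing[of "Domino a" UNIV linear_covered "{a..<b}"] assms
      linear_covered_nonempty by simp
qed

text \<open>A tile covering the leftmost square must start there, since a domino ending at
  \<open>a\<close> would stick out; exactness then admits exactly one such tile.\<close>

lemma interval_tilings_no_Monomino_iff:
  assumes "T \<in> interval_tilings a b" "a < b"
  shows "Monomino a \<notin> T \<longleftrightarrow> Domino a \<in> T"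
proof -
  have sub: "\<forall>d\<in>T. linear_covered d \<subseteq> {a..<b}" and ex: "\<exists>!d. d \<in> T \<and> a \<in> linear_covered d"
    using assms by (auto simp: exact_covers_def)
  from ex obtain d where d: "d \<in> T" "a \<in> linear_covered d" by blast
  then have "d = Monomino a \<or> d = Domino a"
    using sub by (cases d) force+
  with ex d show ?thesis
    by (metis insertI1 linear_covered.simps tile.distinct(1))
qed

lemma interval_tilings_no_Monomino:
  assumes "a < b"
  shows "{T \<in> interval_tilings a b. Monomino a \<notin> T} =
    (if Suc a < b then insert (Domino a) ` interval_tilings (Suc (Suc a)) b else {})"
proof -
  have eq: "{T \<in> interval_tilings a b. Monomino a \<notin> T} = {T \<in> interval_tilings a b. Domino a \<in> T}"
    using interval_tilings_no_Monomino_iff assms by blast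
  show ?thesis
  proof (cases "Suc a < b")
    case True
    with eq interval_tilings_Domino show ?thesis by simp
  next
    case False
    then have "\<not> linear_covered (Domino a) \<subseteq> {a..<b}" by simp
    then have "{T \<in> interval_tilings a b. Domino a \<in> T} = {}"
      by (auto simp: exact_covers_def simp del: linear_covered.simps)
    with eq False show ?thesis by simp
  qed
qed

lemma sum_insert_Monomino:
  "sum linear_weight (insert (Monomino a) ` interval_tilings (Suc a) b) =
    var_s * sum linear_weight (interval_tilings (Suc a) b)"
proof -
  have eq: "{a..<b} - linear_covered (Monomino a) = {Suc a..<b}" by auto
  show ?thesis
    using sum_insert_exact_covers[of linear_covered "Monomino a" UNIV "{a..<b}" linear_weight var_s]
    by (metis eq linear_covered_nonempty finite_interval_tiling linear_weight_insert_Monomino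
        not_mem_exact_covers_diff)
qed

lemma sum_insert_Domino:
  "sum linear_weight (insert (Domino a) ` interval_tilings (Suc (Suc a)) b) =
    var_t * sum linear_weight (interval_tilings (Suc (Suc a)) b)"
proof -
  have eq: "{a..<b} - linear_covered (Domino a) = {Suc (Suc a)..<b}" by auto
  show ?thesis
    using sum_insert_exact_covers[of linear_covered "Domino a" UNIV "{a..<b}" linear_weight var_t]
    by (metis eq linear_covered_nonempty finite_interval_tiling linear_weight_insert_Domino
        not_mem_exact_covers_diff)
qed

lemma interval_tilings_empty: "exact_covers UNIV linear_covered {} = {{}}"
  by (simp add: exact_covers_empty linear_covered_nonempty)

lemma finite_interval_tilings: "finite (interval_tilings a b)"
proof (rule finite_subset)
  show "interval_tilings a b \<subseteq> Pow (Monomino ` {a..<b} \<union> Domino ` {a..<b})"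
  proof (intro subsetI PowI)
    fix T d assume "T \<in> interval_tilings a b" "d \<in> T"
    then show "d \<in> Monomino ` {a..<b} \<union> Domino ` {a..<b}"
      by (cases d) (auto simp: exact_covers_def)
  qed
qed simp

text \<open>Removing the leftmost tile shortens the interval by one or two, which is the recurrence
  of \<open>lucas_poly\<close>.\<close>

lemma sum_interval_tilings:
  "sum linear_weight (interval_tilings a (a + k)) = lucas_poly (Suc k)"
proof (induction k arbitrary: a rule: less_induct)
  case (less k)
  show ?case
  proof (cases k)
    case 0
    then show ?thesis by (simp add: interval_tilings_empty linear_weight_empty)
  next
    case (Suc j)
    have split: "interval_tilings a (a + k) = {T \<in> interval_tilings a (a + k). Monomino a \<in> T} \<union>
        {T \<in> interval_tilings a (a + k). Monomino a \<notin> T}"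
      by blast
    have "sum linear_weight (interval_tilings a (a + k)) =
        sum linear_weight {T \<in> interval_tilings a (a + k). Monomino a \<in> T} +
        sum linear_weight {T \<in> interval_tilings a (a + k). Monomino a \<notin> T}"
      by (subst split, rule sum.union_disjoint) (auto simp: finite_interval_tilings)
    also have "sum linear_weight {T \<in> interval_tilings a (a + k). Monomino a \<in> T} =
        var_s * lucas_poly (Suc j)"
      using less.IH[of j "Suc a"] Suc by (simp add: interval_tilings_Monomino sum_insert_Monomino)
    also have "sum linear_weight {T \<in> interval_tilings a (a + k). Monomino a \<notin> T} =
        var_t * lucas_poly j"
    \<comment> \<open>For length one no domino fits, in agreement with
      \<open>lucas_poly 0 = 0\<close>.\<close>
    proof (cases j)
      case 0
      with Suc show ?thesis by (subst interval_tilings_no_Monomino) simp_all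
    next
      case (Suc i)
      with less.IH[of i "Suc (Suc a)"] \<open>k = Suc j\<close> show ?thesis
        by (simp add: interval_tilings_no_Monomino sum_insert_Domino)
    qed
    finally show ?thesis using Suc by simp
  qed
qed

section \<open>Linear tilings of a row\<close>

lemma linear_tilings_eq: "linear_tilings l = interval_tilings 0 l"
proof -
  have "linear_tilings l = exact_covers (linear_tiles l) (covered l) {0..<l}"
    by (fastforce simp: linear_tilings_def exact_covers_def exact_cover_def linear_tiles_def)
  \<comment> \<open>Linear dominos satisfy \<open>Suc i < l\<close>, so reduction mod
    \<open>l\<close> does nothing to them.\<close>
  also have "\<dots> = interval_tilings 0 l"
  proof (rule exact_covers_cong)
    fix d
    show "d \<in> linear_tiles l \<and> covered l d \<subseteq> {0..<l} \<longleftrightarrow> d \<in> UNIV \<and> linear_covered d \<subseteq> {0..<l}"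
      by (cases d) (auto simp: linear_tiles_def)
  qed (auto simp: linear_tiles_def)
  finally show ?thesis .
qed

lemma sum_linear_tilings: "sum linear_weight (linear_tilings l) = lucas_poly (Suc l)"
  using sum_interval_tilings[of 0 l] by (simp add: linear_tilings_eq)

lemma sum_linear_tilings'_0: "sum linear_weight (linear_tilings' 0) = 1"
proof -
  have "linear_tilings' 0 = {{}}"
    by (auto simp: linear_tilings'_def linear_tilings_eq interval_tilings_empty)
  then show ?thesis by (simp add: linear_weight_empty)
qed

text \<open>For \<open>l > 0\<close> the forced initial domino leaves \<open>l - 1\<close> squares,
  of total weight \<open>lucas_poly l\<close>; for \<open>l = 0\<close> both sides vanish.\<close>

lemma sum_linear_tilings'_Suc:
  "sum linear_weight (linear_tilings' (Suc l)) = var_t * lucas_poly l"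
proof -
  have eq: "linear_tilings' (Suc l) =
      (if 0 < l then insert (Domino 0) ` interval_tilings (Suc (Suc 0)) (Suc l) else {})"
    unfolding linear_tilings'_def linear_tilings_eq
    by (subst interval_tilings_no_Monomino) simp_all
  show ?thesis
  proof (cases l)
    case 0
    with eq show ?thesis by simp
  next
    case (Suc j)
    with eq show ?thesis
      using sum_interval_tilings[of "Suc (Suc 0)" j] by (simp add: sum_insert_Domino)
  qed
qed

section \<open>Circular tilings of a row\<close>

lemma circular_tilings_eq_exact_covers:
  "circular_tilings l = exact_covers (circular_tiles l) (covered l) {..<l}"
proof -
  have "covered l d \<subseteq> {..<l}" if "d \<in> circular_tiles l" for d
    using that by (auto simp: circular_tiles_def)
  then show ?thesis
    by (auto simp: circular_tilings_def exact_covers_def exact_cover_def Ball_def subset_iff)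
qed

text \<open>\<open>Domino l\<close> is the only tile that can cross the seam; forbidding it leaves
  the linear stock.\<close>

lemma circular_tilings_no_wrap:
  "{T \<in> circular_tilings (Suc l). Domino l \<notin> T} = linear_tilings (Suc l)"
proof -
  have "linear_tiles (Suc l) = circular_tiles (Suc l) - {Domino l}"
    by (auto simp: linear_tiles_def circular_tiles_def)
  then show ?thesis
    by (auto simp: linear_tilings_def circular_tilings_def)
qed

text \<open>The seam domino takes the last square and square 0, and the squares 1 to
  \<open>l\<close> between them form an interval, empty for a row of length two.\<close>

lemma circular_tilings_wrap:
  "{T \<in> circular_tilings (Suc (Suc l)). Domino (Suc l) \<in> T} =
    insert (Domino (Suc l)) ` interval_tilings (Suc 0) (Suc l)"
proof -
  let ?l = "Suc (Suc l)"
  have "{T \<in> circular_tilings ?l. Domino (Suc l) \<in> T} = insert (Domino (Suc l)) `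
      exact_covers (circular_tiles ?l) (covered ?l) ({..<?l} - covered ?l (Domino (Suc l)))"
    unfolding circular_tilings_eq_exact_covers
    by (rule exact_covers_containing) (auto simp: circular_tiles_def)
  also have "{..<?l} - covered ?l (Domino (Suc l)) = {Suc 0..<Suc l}"
    by auto
  also have "exact_covers (circular_tiles ?l) (covered ?l) {Suc 0..<Suc l} =
      interval_tilings (Suc 0) (Suc l)"
  proof (rule exact_covers_cong)
    fix d
    show eq: "covered ?l d = linear_covered d" if "covered ?l d \<subseteq> {Suc 0..<Suc l}" for d
      using that by (cases d) auto
    show "d \<in> circular_tiles ?l \<and> covered ?l d \<subseteq> {Suc 0..<Suc l} \<longleftrightarrow>
        d \<in> UNIV \<and> linear_covered d \<subseteq> {Suc 0..<Suc l}"
      by (cases d) (auto simp: circular_tiles_def)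
  qed
  finally show ?thesis .
qed

lemma sum_circular_tilings_0: "sum circular_weight (circular_tilings 0) = 2"
proof -
  have "circular_tilings 0 = {{}}"
    by (auto simp: circular_tilings_def circular_tiles_def exact_cover_def)
  then show ?thesis by (simp add: circular_weight_def)
qed

lemma finite_circular_tilings: "finite (circular_tilings l)"
proof (rule finite_subset)
  show "circular_tilings l \<subseteq> Pow (Monomino ` {..<l} \<union> Domino ` {..<l})"
    by (auto simp: circular_tilings_def circular_tiles_def)
qed simp

text \<open>Split by whether the seam domino occurs. These are the companion Lucas polynomials,
  whose value 2 at index 0 is the weight of the empty circular tiling.\<close>

lemma sum_circular_tilings_Suc:
  "sum circular_weight (circular_tilings (Suc l)) = lucas_poly (Suc (Suc l)) + var_t * lucas_poly l"
proof -
  let ?C = "circular_tilings (Suc l)"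
  \<comment> \<open>Square 0 must be covered, so the exceptional weight 2 does not arise
    here.\<close>
  have "T \<noteq> {}" if "T \<in> ?C" for T
    using that by (auto simp: circular_tilings_def exact_cover_def)
  then have "sum circular_weight ?C = sum linear_weight ?C"
    by (intro sum.cong) (auto simp: circular_weight_def)
  also have "\<dots> = sum linear_weight ({T \<in> ?C. Domino l \<notin> T} \<union> {T \<in> ?C. Domino l \<in> T})"
    by (rule arg_cong[where f = "sum linear_weight"]) blast
  also have "\<dots> = sum linear_weight {T \<in> ?C. Domino l \<notin> T} +
      sum linear_weight {T \<in> ?C. Domino l \<in> T}"
    by (rule sum.union_disjoint) (auto simp: finite_circular_tilings)
  also have "sum linear_weight {T \<in> ?C. Domino l \<notin> T} = lucas_poly (Suc (Suc l))"
    by (simp only: circular_tilings_no_wrap sum_linear_tilings)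
  also have "sum linear_weight {T \<in> ?C. Domino l \<in> T} = var_t * lucas_poly l"
  proof (cases l)
    case 0
    then have "{T \<in> ?C. Domino l \<in> T} = {}"
      by (auto simp: circular_tilings_def circular_tiles_def)
    with 0 show ?thesis by (simp only: sum.empty) simp
  next
    case (Suc j)
    have notin: "Domino l \<notin> T" if "T \<in> interval_tilings (Suc 0) l" for T
      using that by (auto simp: exact_covers_def)
    have "{T \<in> ?C. Domino l \<in> T} = insert (Domino l) ` interval_tilings (Suc 0) l"
      using circular_tilings_wrap[of j] Suc by simp
    moreover have "inj_on (insert (Domino l)) (interval_tilings (Suc 0) l)"
      using notin by (auto intro!: inj_onI simp: insert_ident)
    ultimately have "sum linear_weight {T \<in> ?C. Domino l \<in> T} =
        (\<Sum>T\<in>interval_tilings (Suc 0) l. linear_weight (insert (Domino l) T))"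
      by (simp add: sum.reindex)
    also have "\<dots> = var_t * sum linear_weight (interval_tilings (Suc 0) l)"
      unfolding sum_distrib_left
      using notin finite_interval_tiling by (intro sum.cong linear_weight_insert_Domino) auto
    finally show ?thesis
      using sum_interval_tilings[of "Suc 0" j] Suc by simp
  qed
  finally show ?thesis .
qed

section \<open>Tuples of tilings\<close>

lemma sum_listset:
  fixes w :: "'a \<Rightarrow> 'r :: comm_semiring_1"
  shows "(\<Sum>T\<in>listset As. prod_list (map w T)) = (\<Prod>A\<leftarrow>As. sum w A)"
proof (induction As)
  case (Cons A As)
  have "listset (A # As) = (\<lambda>(x, xs). x # xs) ` (A \<times> listset As)"
    by (auto simp: set_Cons_def)
  moreover have "inj_on (\<lambda>(x, xs). x # xs) (A \<times> listset As)"
    by (auto intro: inj_onI)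
  ultimately have "(\<Sum>T\<in>listset (A # As). prod_list (map w T)) =
      (\<Sum>(x, xs)\<in>A \<times> listset As. w x * prod_list (map w xs))"
    by (simp add: sum.reindex case_prod_unfold)
  also have "\<dots> = sum w A * (\<Sum>T\<in>listset As. prod_list (map w T))"
    by (simp add: sum_product sum.cartesian_product)
  finally show ?case using Cons.IH by simp
qed simp

lemma sum_tuple_weight:
  "(\<Sum>T\<in>listset As \<times> listset Bs. tuple_weight w T) = (\<Prod>A\<leftarrow>As. sum w A) * (\<Prod>B\<leftarrow>Bs. sum w B)"
  by (simp add: tuple_weight_def sum_listset[symmetric] sum_product sum.cartesian_product
      case_prod_unfold)

section \<open>Summation over partitions in a rectangle\<close>

text \<open>\<open>A l\<close> and \<open>B l\<close> stand for the total weight of the tilings of a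
  row or column of length \<open>l\<close>; keeping them abstract serves both identities.\<close>

definition partition_sum ::
    "(nat \<Rightarrow> 'r) \<Rightarrow> (nat \<Rightarrow> 'r) \<Rightarrow> nat \<Rightarrow> nat \<Rightarrow> 'r :: comm_semiring_1" where
  "partition_sum A B m n =
    (\<Sum>lam\<in>partitions_in m n. (\<Prod>l\<leftarrow>lam. A l) * (\<Prod>l\<leftarrow>compl_columns m n lam. B l))"

lemma finite_partitions_in: "finite (partitions_in m n)"
  by (rule finite_subset[OF _ finite_lists_length_eq[of "{..n}" m]])
    (auto simp: partitions_in_def)

lemma partitions_in_0: "partitions_in 0 n = {[]}"
  by (auto simp: partitions_in_def)

lemma partitions_in_0_right: "partitions_in m 0 = {replicate m 0}"
  by (auto simp: partitions_in_def sorted_wrt_iff_nth_less intro: replicate_eqI)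

text \<open>The first part is the largest: if it is not \<open>Suc n\<close>, all parts are at most
  \<open>n\<close>.\<close>

lemma partitions_in_Suc_Suc:
  "partitions_in (Suc m) (Suc n) =
    Cons (Suc n) ` partitions_in m (Suc n) \<union> partitions_in (Suc m) n"
proof (intro equalityI subsetI)
  fix lam assume lam: "lam \<in> partitions_in (Suc m) (Suc n)"
  then obtain p mu where p: "lam = p # mu"
    by (cases lam) (auto simp: partitions_in_def)
  show "lam \<in> Cons (Suc n) ` partitions_in m (Suc n) \<union> partitions_in (Suc m) n"
  proof (cases "p = Suc n")
    case True
    with lam p show ?thesis by (auto simp: partitions_in_def)
  next
    case False
    with lam p have "p \<le> n" by (auto simp: partitions_in_def)
    with lam p have "lam \<in> partitions_in (Suc m) n"
      by (auto simp: partitions_in_def)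
    then show ?thesis ..
  qed
qed (auto simp: partitions_in_def)

lemma compl_columns_0: "compl_columns 0 n lam = replicate n 0"
  by (auto simp: compl_columns_def intro!: replicate_eqI)

text \<open>A full first row has no box in the complement, so deleting it keeps all column
  lengths.\<close>

lemma compl_columns_Cons:
  "compl_columns (Suc m) n (n # lam) = compl_columns m n lam"
proof -
  have "card {i. (i, j) \<in> {..<Suc m} \<times> {..<n} - ferrers (n # lam)} =
      card {i. (i, j) \<in> {..<m} \<times> {..<n} - ferrers lam}" for j
  proof -
    have "{i. (i, j) \<in> {..<Suc m} \<times> {..<n} - ferrers (n # lam)} =
        Suc ` {i. (i, j) \<in> {..<m} \<times> {..<n} - ferrers lam}" (is "?L = Suc ` ?R")
    proof (rule set_eqI)
      fix i
      show "i \<in> ?L \<longleftrightarrow> i \<in> Suc ` ?R"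
        by (cases i) (auto simp: ferrers_def)
    qed
    then show ?thesis by (simp add: card_image)
  qed
  then show ?thesis by (simp add: compl_columns_def)
qed

text \<open>With all parts at most \<open>n\<close>, the new column lies wholly in the complement;
  it comes first because columns are listed from right to left.\<close>

lemma compl_columns_Suc:
  assumes "lam \<in> partitions_in m n"
  shows "compl_columns m (Suc n) lam = m # compl_columns m n lam"
proof -
  have "{i. (i, n) \<in> {..<m} \<times> {..<Suc n} - ferrers lam} = {..<m}"
    using assms by (fastforce simp: ferrers_def partitions_in_def set_conv_nth)
  then show ?thesis
    by (auto simp: compl_columns_def intro!: arg_cong[where f = card])
qed

text \<open>There remain \<open>n\<close> columns of length 0, each contributing the weight of the
  empty tiling; in the circular case this starts the powers of 2.\<close>

lemma partition_sum_0: "partition_sum A B 0 n = B 0 ^ n"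
  by (simp add: partition_sum_def partitions_in_0 compl_columns_0 prod_list_replicate)

lemma partition_sum_0_right: "partition_sum A B m 0 = A 0 ^ m"
  by (simp add: partition_sum_def partitions_in_0_right compl_columns_def prod_list_replicate)

lemma partition_sum_Suc_Suc:
  "partition_sum A B (Suc m) (Suc n) =
    A (Suc n) * partition_sum A B m (Suc n) + B (Suc m) * partition_sum A B (Suc m) n"
proof -
  let ?f = "\<lambda>lam. (\<Prod>l\<leftarrow>lam. A l) * (\<Prod>l\<leftarrow>compl_columns (Suc m) (Suc n) lam. B l)"
  have "Cons (Suc n) ` partitions_in m (Suc n) \<inter> partitions_in (Suc m) n = {}"
    by (auto simp: partitions_in_def)
  then have "partition_sum A B (Suc m) (Suc n) =
      sum ?f (Cons (Suc n) ` partitions_in m (Suc n)) + sum ?f (partitions_in (Suc m) n)"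
    by (simp only: partition_sum_def partitions_in_Suc_Suc)
      (simp add: sum.union_disjoint finite_partitions_in)
  also have "sum ?f (Cons (Suc n) ` partitions_in m (Suc n)) =
      A (Suc n) * partition_sum A B m (Suc n)"
    by (simp add: sum.reindex compl_columns_Cons partition_sum_def sum_distrib_left mult.assoc)
  also have "sum ?f (partitions_in (Suc m) n) = B (Suc m) * partition_sum A B (Suc m) n"
    unfolding partition_sum_def sum_distrib_left
    by (rule sum.cong) (simp_all add: compl_columns_Suc mult.left_commute)
  finally show ?thesis .
qed

section \<open>Lucas polynomials\<close>

text \<open>Both sides obey the same recurrence in \<open>m\<close>. In terms of tilings, a row of
  length \<open>m + n\<close> cut after \<open>m\<close> squares either splits there or has a domino
  across the cut.\<close>

lemma lucas_poly_add:
  "lucas_poly (Suc (m + n)) =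
    lucas_poly (Suc m) * lucas_poly (Suc n) + var_t * lucas_poly m * lucas_poly n"
proof (induction m rule: lucas_poly.induct)
  case (3 m)
  have "lucas_poly (Suc (Suc (Suc m) + n)) =
      var_s * lucas_poly (Suc (Suc m + n)) + var_t * lucas_poly (Suc (m + n))"
    by simp
  also have "\<dots> = lucas_poly (Suc (Suc (Suc m))) * lucas_poly (Suc n) +
      var_t * lucas_poly (Suc (Suc m)) * lucas_poly n"
    unfolding 3 by (simp add: algebra_simps)
  finally show ?case .
qed simp_all

lemma lucas_poly_Suc_nonzero: "lucas_poly (Suc n) \<noteq> 0"
proof -
  \<comment> \<open>Evaluation at s = 1, t = 0 turns the recurrence into F_{n+2} = F_{n+1}.\<close>
  have "poly (poly (lucas_poly (Suc n)) 1) 0 = 1"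
  proof (induction n)
    case (Suc n)
    then show ?case by (simp add: var_s_def var_t_def)
  qed simp
  then show ?thesis by auto
qed

section \<open>Lucas factorials and the common induction\<close>

lemma lucas_fact_0: "lucas_fact 0 = 1"
  by (simp add: lucas_fact_def)

lemma lucas_fact_Suc: "lucas_fact (Suc n) = lucas_poly (Suc n) * lucas_fact n"
  by (simp add: lucas_fact_def mult.commute)

lemma lucas_fact_nonzero: "lucas_fact n \<noteq> 0"
  by (induction n) (simp_all only: lucas_fact_0 lucas_fact_Suc, simp_all add: lucas_poly_Suc_nonzero)

text \<open>\<open>c\<close> is the weight of an empty row: 1 for linear, 2 for circular tilings.
  The denominators are cleared, so the induction stays in the polynomial ring.\<close>

lemma partition_sum_lucas_fact:
  assumes "A 0 = c" "B 0 = c"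
    and rec: "\<And>m n. A (Suc n) * lucas_poly (Suc m) + B (Suc m) * lucas_poly (Suc n) =
      c * lucas_poly (Suc (Suc (m + n)))"
  shows "partition_sum A B m n * (lucas_fact m * lucas_fact n) = c ^ (m + n) * lucas_fact (m + n)"
proof (induction "m + n" arbitrary: m n)
  case 0
  then show ?case by (simp add: partition_sum_0 lucas_fact_0)
next
  case (Suc k)
  show ?case
  proof (cases m)
    case 0
    then show ?thesis by (simp add: partition_sum_0 lucas_fact_0 assms)
  next
    case m: (Suc i)
    show ?thesis
    proof (cases n)
      case 0
      then show ?thesis by (simp add: partition_sum_0_right lucas_fact_0 assms)
    next
      case n: (Suc j)
      let ?F = "c ^ Suc (i + j) * lucas_fact (Suc (i + j))"
      have 1: "partition_sum A B i (Suc j) * (lucas_fact i * lucas_fact (Suc j)) = ?F"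
        using Suc m n by simp
      have 2: "partition_sum A B (Suc i) j * (lucas_fact (Suc i) * lucas_fact j) = ?F"
        using Suc m n by simp
      \<comment> \<open>Splitting \<open>lucas_fact m\<close> in the first summand of the recurrence
        and \<open>lucas_fact n\<close> in the second exposes the two smaller instances, which share
        the value \<open>?F\<close>.\<close>
      have "partition_sum A B m n * (lucas_fact m * lucas_fact n) =
          A (Suc j) * lucas_poly (Suc i) *
            (partition_sum A B i (Suc j) * (lucas_fact i * lucas_fact (Suc j))) +
          B (Suc i) * lucas_poly (Suc j) *
            (partition_sum A B (Suc i) j * (lucas_fact (Suc i) * lucas_fact j))"
        unfolding m n partition_sum_Suc_Suc lucas_fact_Suc by (simp only: algebra_simps)
      also have "\<dots> = (A (Suc j) * lucas_poly (Suc i) + B (Suc i) * lucas_poly (Suc j)) * ?F"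
        unfolding 1 2 by (simp only: distrib_right)
      also have "\<dots> = c ^ (m + n) * lucas_fact (m + n)"
        unfolding rec m n by (simp add: lucas_fact_Suc[of "Suc (i + j)"] del: lucas_poly.simps)
      finally show ?thesis .
    qed
  qed
qed

lemma lucasnomial_eqI:
  assumes "S * (lucas_fact m * lucas_fact n) = c * lucas_fact (m + n)"
  shows "Fract c 1 * lucasnomial (m + n) m = Fract S 1"
  using assms by (simp add: lucasnomial_def eq_fract lucas_fact_nonzero mult.commute)

theorem theorem3p1:
  fixes m n :: nat
  shows "(lucasnomial (m + n) m =
           Fract (\<Sum>lam\<in>partitions_in m n.
                    \<Sum>T\<in>listset (map linear_tilings lam) \<times>
                         listset (map linear_tilings' (compl_columns m n lam)).
                      tuple_weight linear_weight T) 1)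
       \<and> (2 ^ (m + n) * lucasnomial (m + n) m =
           Fract (\<Sum>lam\<in>partitions_in m n.
                    \<Sum>T\<in>listset (map circular_tilings lam) \<times>
                         listset (map circular_tilings (compl_columns m n lam)).
                      tuple_weight circular_weight T) 1)"
proof
  let ?A = "\<lambda>l. sum linear_weight (linear_tilings l)"
  let ?B = "\<lambda>l. sum linear_weight (linear_tilings' l)"
  have "partition_sum ?A ?B m n * (lucas_fact m * lucas_fact n) = 1 ^ (m + n) * lucas_fact (m + n)"
  proof (rule partition_sum_lucas_fact)
    fix m n
    show "?A (Suc n) * lucas_poly (Suc m) + ?B (Suc m) * lucas_poly (Suc n) =
        1 * lucas_poly (Suc (Suc (m + n)))"
      \<comment> \<open>Here \<open>?A (Suc n)\<close> is F_{n+2} and \<open>?B (Suc m)\<close> is t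
        F_m.\<close>
      using lucas_poly_add[of m "Suc n"]
      by (simp add: sum_linear_tilings sum_linear_tilings'_Suc mult.commute del: lucas_poly.simps)
  qed (simp_all add: sum_linear_tilings sum_linear_tilings'_0)
  from lucasnomial_eqI[OF this] show "lucasnomial (m + n) m =
      Fract (\<Sum>lam\<in>partitions_in m n. \<Sum>T\<in>listset (map linear_tilings lam) \<times>
        listset (map linear_tilings' (compl_columns m n lam)). tuple_weight linear_weight T) 1"
    by (simp add: sum_tuple_weight partition_sum_def comp_def One_fract_def[symmetric])
next
  let ?C = "\<lambda>l. sum circular_weight (circular_tilings l)"
  have "partition_sum ?C ?C m n * (lucas_fact m * lucas_fact n) = 2 ^ (m + n) * lucas_fact (m + n)"
  proof (rule partition_sum_lucas_fact)
    fix m n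
    show "?C (Suc n) * lucas_poly (Suc m) + ?C (Suc m) * lucas_poly (Suc n) =
        2 * lucas_poly (Suc (Suc (m + n)))"
      \<comment> \<open>Expanding \<open>?C\<close> gives four products, which pair up into these
        two instances, each equal to F_{m+n+2}.\<close>
      using lucas_poly_add[of m "Suc n"] lucas_poly_add[of "Suc m" n]
      by (simp add: sum_circular_tilings_Suc algebra_simps del: lucas_poly.simps)
  qed (simp_all add: sum_circular_tilings_0)
  \<comment> \<open>The constant from the polynomial ring has to be identified with the one in the
    fraction field.\<close>
  moreover have "Fract (2 ^ k) 1 = (2 ^ k :: poly_st fract)" for k
  proof (induction k)
    case (Suc k)
    have "Fract (2 ^ Suc k) 1 = Fract 2 1 * Fract (2 ^ k) (1 :: poly_st)" by simp
    also have "Fract 2 (1 :: poly_st) = 2"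
      using Fract_of_nat_eq[where 'a = poly_st, of 2] by simp
    finally show ?case using Suc by simp
  qed (simp add: One_fract_def)
  ultimately show "2 ^ (m + n) * lucasnomial (m + n) m =
      Fract (\<Sum>lam\<in>partitions_in m n. \<Sum>T\<in>listset (map circular_tilings lam) \<times>
        listset (map circular_tilings (compl_columns m n lam)). tuple_weight circular_weight T) 1"
    using lucasnomial_eqI[of "partition_sum ?C ?C m n" m n "2 ^ (m + n)"]
    by (simp add: sum_tuple_weight partition_sum_def comp_def)
qed

end
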